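(* Let $m,k$ be integers with $0 < k \le \lfloor\frac{m-1}{2}\rfloor$. Then 1. $\mathcal{G}(\mathcal{P}_{1,1}(m,k)) \in \{0,1,2\}$; 2. $\mathcal{G}(\mathcal{P}_{0,1}(m,k)) \in \{0,1\}$ and $\mathcal{G}(\mathcal{P}_{1,0}(m,k)) \in \{0,1\}$.
   Context: Toggle: Let $G$ be a finite simple graph, with $N[v]$ the closed neighborhood of $v$. A position $\{G,V_0\}$ consists of $G$ and a set $V_0\subseteq V(G)$ of vertices of weight $0$; all other vertices have weight $1$. Let $\sigma(v)$ be the sum of the weights of the vertices in $N[v]$. A legal move consists of choosing a vertex $v$ of weight $1$ and switching the weight ($0\leftrightarrow 1$) of every vertex of $N[v]$; it is allowed only if $\sigma(v)$ after the switch is strictly smaller than $\sigma(v)$ before it. Two players alternate legal moves; a player with no legal move loses. Nimbers: $\mathcal{G}(\mathcal{S})=\mathrm{mex}\{\mathcal{G}(\mathcal{S}') : \mathcal{S}' \text{ reachable from } \mathcal{S} \text{ by one legal move}\}$, where $\mathrm{mex}(T)$ is the least nonnegative integer not in the finite set $T$ (so $\mathrm{mex}(\emptyset)=0$). The generalized Petersen graph $P(m,k)$ has inner vertices $v_{0,1},\dots,v_{0,m}$ and outer vertices $v_{1,1},\dots,v_{1,m}$ (second indices modulo $m$), with edges $v_{1,i}v_{1,i+1}$, $v_{0,i}v_{0,i+k}$ and $v_{0,i}v_{1,i}$ for all $i$. Positions on $P(m,k)$: $\mathcal{P}_{0,1}(m,k)$ has all inner vertices of weight $0$ and all outer vertices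 of weight $1$; $\mathcal{P}_{1,0}(m,k)$ has all inner vertices of weight $1$ and all outer vertices of weight $0$; $\mathcal{P}_{1,1}(m,k)$ has all vertices of weight $1$. *)

theory Defs
  imports "Graph_Theory.Pair_Digraph"
begin

text \<open>
  A finite simple graph is a digraph satisfying the locale \<open>pair_graph\<close>: finite, loop-free, and with
  a symmetric set of arcs. A position \<open>{G, V0}\<close> is represented by the graph \<open>G\<close> together with
  the set \<open>V0\<close> of its vertices of weight 0.
\<close>

definition closed_neighborhood :: "'a pair_pre_digraph \<Rightarrow> 'a \<Rightarrow> 'a set" where
  "closed_neighborhood G v = insert v {u. (v, u) \<in> parcs G}"

definition weight :: "'a set \<Rightarrow> 'a \<Rightarrow> nat" where
  "weight V0 v = (if v \<in> V0 then 0 else 1)"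

definition weight_sum :: "'a pair_pre_digraph \<Rightarrow> 'a set \<Rightarrow> 'a \<Rightarrow> nat" where
  "weight_sum G V0 v = (\<Sum>u\<in>closed_neighborhood G v. weight V0 u)"

text \<open>Switching all weights in a set \<open>N\<close> replaces \<open>V0\<close> by its symmetric difference with \<open>N\<close>.\<close>

definition switch :: "'a set \<Rightarrow> 'a set \<Rightarrow> 'a set" where
  "switch N V0 = (V0 - N) \<union> (N - V0)"

definition legal_move :: "'a pair_pre_digraph \<Rightarrow> 'a set \<Rightarrow> 'a set \<Rightarrow> bool" where
  "legal_move G V0 V1 \<longleftrightarrow>
    (\<exists>v\<in>pverts G. weight V0 v = 1 \<and> V1 = switch (closed_neighborhood G v) V0 \<and>
       weight_sum G V1 v < weight_sum G V0 v)"

definition mex :: "nat set \<Rightarrow> nat" where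
  "mex T = (LEAST n. n \<notin> T)"

lemma weight_switch_outside: "u \<notin> N \<Longrightarrow> weight (switch N V0) u = weight V0 u"
  by (simp add: weight_def switch_def)

context pair_graph
begin

lemma closed_neighborhood_subset:
  "v \<in> pverts G \<Longrightarrow> closed_neighborhood G v \<subseteq> pverts G"
  by (auto simp: closed_neighborhood_def dest: in_arcsD2)

lemma legal_move_total_weight:
  assumes "legal_move G V0 V1"
  shows "sum (weight V1) (pverts G) < sum (weight V0) (pverts G)"
proof -
  obtain v where v: "v \<in> pverts G" and V1: "V1 = switch (closed_neighborhood G v) V0"
    and less: "weight_sum G V1 v < weight_sum G V0 v"
    using assms by (auto simp: legal_move_def)
  let ?N = "closed_neighborhood G v"
  have split: "sum (weight W) (pverts G) = sum (weight W) (pverts G - ?N) + weight_sum G W v" for W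
    unfolding weight_sum_def
    by (rule sum.subset_diff[OF closed_neighborhood_subset[OF v] pair_finite_verts])
  have "sum (weight V1) (pverts G - ?N) = sum (weight V0) (pverts G - ?N)"
    by (rule sum.cong) (auto simp: V1 weight_switch_outside)
  with less show ?thesis by (simp add: split)
qed

text \<open>The recursion is well-founded because every legal move decreases the total weight.\<close>

function nimber :: "'a set \<Rightarrow> nat" where
  "nimber V0 = mex (nimber ` {V1. legal_move G V0 V1})"
  by auto
termination
  by (relation "measure (\<lambda>V0. sum (weight V0) (pverts G))") (auto intro: legal_move_total_weight)

declare nimber.simps [simp del]

end

text \<open>
  The vertex \<open>v_{j,i}\<close> is the pair \<open>(j, i)\<close>, with \<open>j = 0\<close> for inner and \<open>j = 1\<close> for outer vertices;
  the indices modulo \<open>m\<close> are represented by \<open>0, ..., m - 1\<close>.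
\<close>

definition inner_vertices :: "nat \<Rightarrow> (nat \<times> nat) set" where
  "inner_vertices m = {0} \<times> {..<m}"

definition outer_vertices :: "nat \<Rightarrow> (nat \<times> nat) set" where
  "outer_vertices m = {1} \<times> {..<m}"

definition petersen_arcs :: "nat \<Rightarrow> nat \<Rightarrow> (nat \<times> nat) rel" where
  "petersen_arcs m k =
    (\<Union>i<m. {((1, i), (1, (i + 1) mod m)), ((0, i), (0, (i + k) mod m)), ((0, i), (1, i))})"

definition petersen :: "nat \<Rightarrow> nat \<Rightarrow> (nat \<times> nat) pair_pre_digraph" where
  "petersen m k =
    \<lparr> pverts = inner_vertices m \<union> outer_vertices m,
      parcs = petersen_arcs m k \<union> (petersen_arcs m k)\<inverse> \<rparr>"

lemma pair_graph_petersen: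
  assumes "0 < k" "k \<le> (m - 1) div 2"
  shows "pair_graph (petersen m k)"
proof -
  have m: "1 < m" "k < m" using assms by auto
  have shift: "(i + d) mod m \<noteq> i" if "i < m" "0 < d" "d < m" for i d
  proof (cases "i + d < m")
    case False
    then have "(i + d) mod m = i + d - m" using that by (simp add: le_mod_geq)
    then show ?thesis using that False by linarith
  qed (use that in simp)
  have fin: "finite (petersen_arcs m k)" by (simp add: petersen_arcs_def)
  have verts: "fst e \<in> pverts (petersen m k) \<and> snd e \<in> pverts (petersen m k)"
    if "e \<in> petersen_arcs m k" for e
    using that m
    by (auto simp: petersen_arcs_def petersen_def inner_vertices_def outer_vertices_def)
  have loops: "fst e \<noteq> snd e" if "e \<in> petersen_arcs m k" for e
    using that shift[of _ 1] shift[of _ k] m assms(1) by (fastforce simp: petersen_arcs_def)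
  have arcs: "e \<in> petersen_arcs m k \<or> prod.swap e \<in> petersen_arcs m k"
    if "e \<in> parcs (petersen m k)" for e
    using that by (cases e) (auto simp: petersen_def)
  show ?thesis
  proof unfold_locales
    fix e assume e: "e \<in> parcs (petersen m k)"
    show "fst e \<in> pverts (petersen m k)" "snd e \<in> pverts (petersen m k)" "fst e \<noteq> snd e"
      using arcs[OF e] verts[of e] verts[of "prod.swap e"] loops[of e] loops[of "prod.swap e"]
      by auto
  next
    show "finite (pverts (petersen m k))"
      by (simp add: petersen_def inner_vertices_def outer_vertices_def)
    show "finite (parcs (petersen m k))" using fin by (simp add: petersen_def)
    show "symmetric (with_proj (petersen m k))"
      by (auto simp: symmetric_def petersen_def arcs_ends_def arc_to_ends_def
          with_proj_def sym_def)
  qed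
qed

text \<open>The positions on \<open>P(m,k)\<close>, given by their sets of vertices of weight 0; the two
  subscripts are the weights of the inner and of the outer vertices.\<close>

definition petersen_pos_11 :: "nat \<Rightarrow> (nat \<times> nat) set" where
  "petersen_pos_11 m = {}"

definition petersen_pos_01 :: "nat \<Rightarrow> (nat \<times> nat) set" where
  "petersen_pos_01 m = inner_vertices m"

definition petersen_pos_10 :: "nat \<Rightarrow> (nat \<times> nat) set" where
  "petersen_pos_10 m = outer_vertices m"

end

theory Submission
  imports Defs "HOL-Number_Theory.Cong"
begin

text \<open>
  The rotations of \<open>P(m,k)\<close> are automorphisms and fix each of the three positions, so
  the nimber of an option depends only on whether an inner or an outer vertex was chosen. Hence
  the options of \<open>\<P>\<^sub>1\<^sub>,\<^sub>1\<close> have at most two nimbers, while in the other two positions only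
  one kind of vertex has weight 1 and the options have at most one nimber. A set with at most
  \<open>n\<close> elements has mex at most \<open>n\<close>.
\<close>

text \<open>Pigeonhole: a larger mex would put all the \<open>card T + 1\<close> numbers up to
  \<open>card T\<close> into \<open>T\<close>.\<close>

lemma mex_le_card:
  assumes "finite T"
  shows "mex T \<le> card T"
proof (rule ccontr)
  assume "\<not> mex T \<le> card T"
  then have "n \<in> T" if "n \<le> card T" for n
    using that not_less_Least[of n "\<lambda>n. n \<notin> T"] unfolding mex_def by linarith
  then have "{..card T} \<subseteq> T"
    by blast
  then show False
    using card_mono[OF assms, of "{..card T}"] by simp
qed

lemma weight_image:
  assumes "inj_on f A" "V \<subseteq> A" "v \<in> A"
  shows "weight (f ` V) (f v) = weight V v"
  using inj_on_image_mem_iff[OF assms(1,3,2)] by (simp add: weight_def)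

lemma switch_image:
  assumes "inj_on f A" "N \<subseteq> A" "V \<subseteq> A"
  shows "switch (f ` N) (f ` V) = f ` switch N V"
proof -
  have "f ` (N - V) = f ` N - f ` V" "f ` (V - N) = f ` V - f ` N"
    using assms by (auto intro!: inj_on_image_set_diff[OF assms(1)])
  then show ?thesis
    by (simp add: switch_def image_Un)
qed

text \<open>Isomorphic positions have equal nimbers, by induction along the game recursion.
  Compatibility of \<open>f\<close> with the graphs is asked for closed neighborhoods, not arcs,
  because legal moves see the arcs only through them.\<close>

lemma nimber_image:
  assumes G: "pair_graph G" and H: "pair_graph H"
    and inj: "inj_on f (pverts G)" and verts: "pverts H = f ` pverts G"
    and nbh: "\<And>v. v \<in> pverts G \<Longrightarrow>
      closed_neighborhood H (f v) = f ` closed_neighborhood G v"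
    and "V \<subseteq> pverts G"
  shows "pair_graph.nimber H (f ` V) = pair_graph.nimber G V"
  using \<open>V \<subseteq> pverts G\<close>
proof (induction V rule: pair_graph.nimber.induct[OF G])
  case (1 V)
  let ?N = "closed_neighborhood G"
  note sub = pair_graph.closed_neighborhood_subset[OF G]
  have switch_sub: "switch (?N v) V \<subseteq> pverts G" if "v \<in> pverts G" for v
    using sub[OF that] "1.prems" by (auto simp: switch_def)
  have weight_sum: "weight_sum H (f ` W) (f v) = weight_sum G W v"
    if "v \<in> pverts G" "W \<subseteq> pverts G" for v W
  proof -
    have "inj_on f (?N v)"
      using inj sub[OF that(1)] by (rule inj_on_subset)
    moreover have "weight (f ` W) (f u) = weight W u" if "u \<in> ?N v" for u
      using weight_image[OF inj] \<open>W \<subseteq> pverts G\<close> sub[OF \<open>v \<in> pverts G\<close>] that by blast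
    ultimately show ?thesis
      unfolding weight_sum_def nbh[OF that(1)] by (simp add: sum.reindex)
  qed
  have switch: "switch (closed_neighborhood H (f v)) (f ` V) = f ` switch (?N v) V"
    if "v \<in> pverts G" for v
    unfolding nbh[OF that] using inj sub[OF that] "1.prems" by (rule switch_image)
  \<comment> \<open>Choosing \<open>f v\<close> in \<open>H\<close> mirrors choosing
    \<open>v\<close> in \<open>G\<close>: weights, weight sums and switched sets all correspond.
    Positions are sets, so \<open>image f\<close> is the induced map on them.\<close>
  have "legal_move H (f ` V) W \<longleftrightarrow> W \<in> image f ` {V1. legal_move G V V1}" for W
  proof -
    have "legal_move H (f ` V) W \<longleftrightarrow>
      (\<exists>v\<in>pverts G. weight V v = 1 \<and> W = f ` switch (?N v) V \<and>
        weight_sum G (switch (?N v) V) v < weight_sum G V v)"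
      unfolding legal_move_def verts bex_simps
      using "1.prems" by (intro bex_cong refl)
        (auto simp: switch weight_sum switch_sub weight_image[OF inj])
    then show ?thesis
      by (auto simp: legal_move_def)
  qed
  then have options: "{W. legal_move H (f ` V) W} = image f ` {V1. legal_move G V V1}"
    by blast
  \<comment> \<open>The induction hypothesis applies because a move never leaves the vertex set,
    outside of which nothing is known about \<open>f\<close>.\<close>
  have "pair_graph.nimber H (f ` V1) = pair_graph.nimber G V1" if "legal_move G V V1" for V1
  proof (rule "1.IH")
    show "V1 \<in> {V1. legal_move G V V1}"
      using that by simp
    show "V1 \<subseteq> pverts G"
      using that switch_sub by (auto simp: legal_move_def)
  qed
  then have "pair_graph.nimber H ` image f ` {V1. legal_move G V V1} =
      pair_graph.nimber G ` {V1. legal_move G V V1}"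
    unfolding image_image by (intro image_cong) simp_all
  then show ?case
    unfolding pair_graph.nimber.simps[OF H, of "f ` V"] pair_graph.nimber.simps[OF G, of V] options
    by simp
qed

text \<open>Both layers turn by the same \<open>r\<close>, so that the edges joining inner to outer
  vertices are preserved too.\<close>

definition rotate_index :: "nat \<Rightarrow> nat \<Rightarrow> nat \<times> nat \<Rightarrow> nat \<times> nat" where
  "rotate_index m r = (\<lambda>(j, i). (j, (i + r) mod m))"

lemma inj_on_add_mod: "inj_on (\<lambda>i. (i + r) mod m) {..<m :: nat}"
proof (rule inj_onI)
  fix i j assume "i \<in> {..<m}" "j \<in> {..<m}" "(i + r) mod m = (j + r) mod m"
  then have "[i = j] (mod m)"
    unfolding cong_def[symmetric] by (simp add: cong_add_rcancel_nat)
  with \<open>i \<in> {..<m}\<close> \<open>j \<in> {..<m}\<close> show "i = j"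
    by (simp add: cong_def)
qed

lemma image_add_mod: "(\<lambda>i. (i + r) mod m) ` {..<m :: nat} = {..<m}"
  by (rule endo_inj_surj) (auto simp: inj_on_add_mod)

lemma inj_on_rotate_index: "inj_on (rotate_index m r) (UNIV \<times> {..<m})"
  by (rule inj_onI) (auto simp: rotate_index_def dest: inj_onD[OF inj_on_add_mod])

text \<open>With \<open>J\<close> equal to \<open>{0, 1}\<close> this is invariance of the vertex
  set; with \<open>{}\<close>, \<open>{0}\<close> and \<open>{1}\<close> it is invariance of the
  weight-0 sets of the three positions.\<close>

lemma rotate_index_image: "rotate_index m r ` (J \<times> {..<m}) = J \<times> {..<m}"
proof -
  have "rotate_index m r = map_prod id (\<lambda>i. (i + r) mod m)"
    by (auto simp: rotate_index_def)
  then show ?thesis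
    using image_add_mod[of r m] by (simp add: map_prod_surj_on)
qed

lemma pverts_petersen: "pverts (petersen m k) = {0, 1} \<times> {..<m}"
  by (auto simp: petersen_def inner_vertices_def outer_vertices_def)

text \<open>Adding \<open>r\<close> commutes modulo \<open>m\<close> with adding 1 or
  \<open>k\<close>, so the three arcs listed for \<open>i\<close> go to those listed for
  \<open>(i + r) mod m\<close>, and these indices again run through all of
  \<open>{..<m}\<close>.\<close>

lemma rotate_index_petersen_arcs:
  "map_prod (rotate_index m r) (rotate_index m r) ` petersen_arcs m k = petersen_arcs m k"
proof -
  define A where "A i = {((1 :: nat, i), (1 :: nat, (i + 1) mod m)),
    ((0, i), (0, (i + k) mod m)), ((0, i), (1, i))}" for i
  have "map_prod (rotate_index m r) (rotate_index m r) ` A i = A ((i + r) mod m)" for i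
    by (simp add: A_def rotate_index_def mod_simps add.commute add.left_commute)
  then have "map_prod (rotate_index m r) (rotate_index m r) ` (\<Union>i<m. A i)
      = (\<Union>i\<in>(\<lambda>i. (i + r) mod m) ` {..<m}. A i)"
    by (simp add: image_UN)
  then show ?thesis
    unfolding image_add_mod by (simp add: petersen_arcs_def A_def)
qed

lemma rotate_index_parcs:
  "map_prod (rotate_index m r) (rotate_index m r) ` parcs (petersen m k) = parcs (petersen m k)"
proof -
  have "map_prod f f ` (R\<inverse>) = (map_prod f f ` R)\<inverse>" 
    for f :: "nat \<times> nat \<Rightarrow> nat \<times> nat" and R
    by force
  then show ?thesis
    by (simp add: petersen_def image_Un rotate_index_petersen_arcs)
qed

context
  fixes m k :: nat
  assumes k: "0 < k" "k \<le> (m - 1) div 2"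
begin

interpretation pair_graph "petersen m k"
  using k by (rule pair_graph_petersen)

lemma closed_neighborhood_rotate_index:
  assumes v: "v \<in> pverts (petersen m k)"
  shows "closed_neighborhood (petersen m k) (rotate_index m r v) =
    rotate_index m r ` closed_neighborhood (petersen m k) v"
proof -
  have "(rotate_index m r v, u) \<in> parcs (petersen m k) \<longleftrightarrow>
    (\<exists>w. (v, w) \<in> parcs (petersen m k) \<and> u = rotate_index m r w)" for u
  proof
    assume "(rotate_index m r v, u) \<in> parcs (petersen m k)"
    then obtain a w where "(a, w) \<in> parcs (petersen m k)"
      "rotate_index m r v = rotate_index m r a" "u = rotate_index m r w"
      by (subst (asm) rotate_index_parcs[of m r, symmetric]) auto
    \<comment> \<open>Invariance of the arc set only yields an arc from some \<open>a\<close> with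
      the same image as \<open>v\<close>. Both are vertices, where the rotation is
      injective.\<close>
    moreover from this have "a = v"
      using inj_onD[OF inj_on_rotate_index, of m r v a] v in_arcsD1
      by (fastforce simp: pverts_petersen)
    ultimately show "\<exists>w. (v, w) \<in> parcs (petersen m k) \<and> u = rotate_index m r w"
      by blast
  next
    assume "\<exists>w. (v, w) \<in> parcs (petersen m k) \<and> u = rotate_index m r w"
    then show "(rotate_index m r v, u) \<in> parcs (petersen m k)"
      by (subst rotate_index_parcs[of m r, symmetric]) force
  qed
  then show ?thesis
    by (auto simp: closed_neighborhood_def)
qed

text \<open>The rotation by \<open>i\<close> fixes \<open>J \<times> {..<m}\<close> and carries
  \<open>(j, 0)\<close> to \<open>(j, i)\<close>, hence one option to the other.\<close>

lemma nimber_switch_eq: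
  assumes "j \<in> {0, 1}" "i < m" "J \<subseteq> {0, 1}"
  shows "nimber (switch (closed_neighborhood (petersen m k) (j, i)) (J \<times> {..<m})) =
    nimber (switch (closed_neighborhood (petersen m k) (j, 0)) (J \<times> {..<m}))"
proof -
  let ?f = "rotate_index m i" and ?N = "closed_neighborhood (petersen m k)"
  have inj: "inj_on ?f (pverts (petersen m k))"
    using inj_on_rotate_index by (rule inj_on_subset) (auto simp: pverts_petersen)
  have v: "(j, 0) \<in> pverts (petersen m k)" and J: "J \<times> {..<m} \<subseteq> pverts (petersen m k)"
    using assms by (auto simp: pverts_petersen)
  note sub = closed_neighborhood_subset[OF v]
  have "?N (j, i) = ?f ` ?N (j, 0)"
    using closed_neighborhood_rotate_index[OF v, of i] assms by (simp add: rotate_index_def)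
  then have "switch (?N (j, i)) (J \<times> {..<m}) = ?f ` switch (?N (j, 0)) (J \<times> {..<m})"
    using switch_image[OF inj sub J] by (simp add: rotate_index_image)
  moreover have "switch (?N (j, 0)) (J \<times> {..<m}) \<subseteq> pverts (petersen m k)"
    using sub J by (auto simp: switch_def)
  ultimately show ?thesis
    using nimber_image[OF pair_graph_axioms pair_graph_axioms inj _
        closed_neighborhood_rotate_index]
    by (simp add: pverts_petersen rotate_index_image)
qed

text \<open>\<open>J\<close> is the set of layers of weight 0. Moves choose vertices in the
  remaining layers, and each of these contributes at most one nimber, so the mex is at most their
  number.\<close>

lemma nimber_le_card_layers:
  assumes "J \<subseteq> {0, 1}"
  shows "nimber (J \<times> {..<m}) \<le> card ({0, 1} - J)"
proof -
  let ?V = "J \<times> {..<m}"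
  \<comment> \<open>The index 0 serves as the representative of the whole layer
    \<open>j\<close>.\<close>
  define g where "g j = nimber (switch (closed_neighborhood (petersen m k) (j, 0)) ?V)" for j
  let ?T = "nimber ` {V. legal_move (petersen m k) ?V V}"
  have "nimber V \<in> g ` ({0, 1} - J)" if move: "legal_move (petersen m k) ?V V" for V
  proof -
    obtain v where v: "v \<in> pverts (petersen m k)" "weight ?V v = 1"
      and V: "V = switch (closed_neighborhood (petersen m k) v) ?V"
      using move unfolding legal_move_def by blast
    obtain j i where ji: "v = (j, i)"
      by (cases v)
    have j: "j \<in> {0, 1}" and i: "i < m"
      using v(1) by (simp_all add: ji pverts_petersen)
    have "j \<notin> J"
      using v(2) i by (auto simp: ji weight_def)
    moreover have "nimber V = g j"
      unfolding V ji g_def using j i assms by (rule nimber_switch_eq)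
    ultimately show ?thesis
      using j by blast
  qed
  then have sub: "?T \<subseteq> g ` ({0, 1} - J)"
    by blast
  have "nimber ?V = mex ?T"
    by (rule nimber.simps)
  also have "\<dots> \<le> card ?T"
    using finite_subset[OF sub] by (intro mex_le_card) simp
  also have "\<dots> \<le> card ({0, 1} - J)"
    using sub by (intro surj_card_le) simp_all
  finally show ?thesis .
qed

end

theorem theorem4p6:
  fixes m k :: nat
  assumes "0 < k" and "k \<le> (m - 1) div 2"
  shows "pair_graph.nimber (petersen m k) (petersen_pos_11 m) \<in> {0, 1, 2} \<and>
    (pair_graph.nimber (petersen m k) (petersen_pos_01 m) \<in> {0, 1} \<and>
     pair_graph.nimber (petersen m k) (petersen_pos_10 m) \<in> {0, 1})"
proof -
  \<comment> \<open>The three positions leave 2, 1 and 1 layers of weight 1, which gives the three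
    bounds.\<close>
  note bound = nimber_le_card_layers[OF assms]
  have "pair_graph.nimber (petersen m k) (petersen_pos_11 m) \<le> 2"
    using bound[of "{}"] by (simp add: petersen_pos_11_def)
  moreover have "pair_graph.nimber (petersen m k) (petersen_pos_01 m) \<le> 1"
    using bound[of "{0}"] by (simp add: petersen_pos_01_def inner_vertices_def)
  moreover have "pair_graph.nimber (petersen m k) (petersen_pos_10 m) \<le> 1"
    using bound[of "{1}"] by (simp add: petersen_pos_10_def outer_vertices_def insert_Diff_if)
  ultimately show ?thesis
    by auto
qed

end
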